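(* For every integer $k\ge 2$, the Baumslag--Solitar group $\mathrm{BS}(1,k)\cong \mathbb{Z}\left[\frac1k\right]\rtimes_k\mathbb{Z}$ does not have uniformly almost flat quotients (the u.q. property).
   Context: In $\mathbb{Z}[\frac1k]\rtimes_k\mathbb{Z}$ the generator of $\mathbb{Z}$ acts on $\mathbb{Z}[\frac1k]$ by multiplication by $k$. Let $G$ be an infinite group generated by a finite set $S$ and admitting a strictly decreasing sequence of finite-index subgroups. For a finite-index normal subgroup $N\trianglelefteq G$, $\operatorname{diam}_S(G/N)$ denotes the diameter of the Cayley graph of $G/N$ with respect to the image of $S$, i.e. the least $n\ge 0$ such that every element of $G/N$ is a product of at most $n$ images of elements of $S\cup S^{-1}$. For $\alpha\in(0,1]$, $G$ has uniformly $\alpha$-almost flat quotients, written u.q.$(\alpha)$, if there exists $\varepsilon>0$ such that $\operatorname{diam}_S(G/N)\ge \varepsilon [G:N]^\alpha$ for every proper finite-index normal subgroup $N\trianglelefteq G$; this does not depend on the choice of the finite generating set $S$. $G$ has uniformly almost flat quotients (the u.q. property) if it has u.q.$(\alpha)$ for some $\alpha\in(0,1]$. *)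

theory Defs
  imports Complex_Main "HOL-Algebra.Generated_Groups"
begin

section \<open>Groups given by generators and relations\<close>

text \<open>A letter \<open>(x, True)\<close> stands for the generator \<open>x\<close>, and \<open>(x, False)\<close> for its formal inverse.\<close>

type_synonym 'a word = "('a \<times> bool) list"

text \<open>\<open>presented_eq R u v\<close>: the words \<open>u\<close> and \<open>v\<close> represent the same element of the group generated
  by the letters of type \<open>'a\<close> subject to the relations \<open>l = r\<close>, where \<open>(l, r) \<in> R\<close>.\<close>

inductive presented_eq :: "('a word \<times> 'a word) set \<Rightarrow> 'a word \<Rightarrow> 'a word \<Rightarrow> bool"
  for R :: "('a word \<times> 'a word) set" where
  cancel: "presented_eq R [(x, b), (x, \<not> b)] []"
| relation: "(l, r) \<in> R \<Longrightarrow> presented_eq R l r"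
| refl: "presented_eq R u u"
| sym: "presented_eq R u v \<Longrightarrow> presented_eq R v u"
| trans: "presented_eq R u v \<Longrightarrow> presented_eq R v w \<Longrightarrow> presented_eq R u w"
| append: "presented_eq R u u' \<Longrightarrow> presented_eq R v v' \<Longrightarrow> presented_eq R (u @ v) (u' @ v')"

definition presented_group :: "('a word \<times> 'a word) set \<Rightarrow> 'a word set monoid" where
  "presented_group R =
    \<lparr>carrier = UNIV // {(u, v). presented_eq R u v},
     mult = (\<lambda>A B. {w. \<exists>u\<in>A. \<exists>v\<in>B. presented_eq R (u @ v) w}),
     one = {w. presented_eq R [] w}\<rparr>"


section \<open>Baumslag--Solitar groups\<close>

datatype BS_gen = Gen_a | Gen_t

definition gen_pow :: "'a \<Rightarrow> int \<Rightarrow> 'a word" where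
  "gen_pow x n = replicate (nat \<bar>n\<bar>) (x, n \<ge> 0)"

text \<open>\<open>BS(m, n) = \<langle>a, t | t a\<^sup>m t\<inverse> = a\<^sup>n\<rangle>\<close>\<close>

definition BS :: "int \<Rightarrow> int \<Rightarrow> BS_gen word set monoid" where
  "BS m n = presented_group
    {(gen_pow Gen_t 1 @ gen_pow Gen_a m @ gen_pow Gen_t (- 1), gen_pow Gen_a n)}"

definition Z_inverted :: "int \<Rightarrow> rat set" where
  "Z_inverted k = {of_int c / of_int k ^ n | (c :: int) (n :: nat). True}"

definition Z_inverted_semidirect_Z :: "int \<Rightarrow> (rat \<times> int) monoid" where
  "Z_inverted_semidirect_Z k =
    \<lparr>carrier = Z_inverted k \<times> UNIV,
     mult = (\<lambda>(x, i) (y, j). (x + of_int k powi i * y, i + j)),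
     one = (0, 0)\<rparr>"


section \<open>Uniformly almost flat quotients\<close>

definition finite_generating_set :: "('g, 'b) monoid_scheme \<Rightarrow> 'g set \<Rightarrow> bool" where
  "finite_generating_set G S \<longleftrightarrow> finite S \<and> S \<subseteq> carrier G \<and> generate G S = carrier G"

definition finite_index :: "('g, 'b) monoid_scheme \<Rightarrow> 'g set \<Rightarrow> bool" where
  "finite_index G H \<longleftrightarrow> finite (rcosets\<^bsub>G\<^esub> H)"

definition index :: "('g, 'b) monoid_scheme \<Rightarrow> 'g set \<Rightarrow> nat" where
  "index G H = card (rcosets\<^bsub>G\<^esub> H)"

text \<open>The class of groups for which the u.q. property is considered.\<close>

definition uq_setting :: "('g, 'b) monoid_scheme \<Rightarrow> bool" where
  "uq_setting G \<longleftrightarrow> group G \<and> infinite (carrier G) \<and> (\<exists>S. finite_generating_set G S) \<and>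
    (\<exists>H :: nat \<Rightarrow> 'g set. \<forall>n. subgroup (H n) G \<and> finite_index G (H n) \<and> H (Suc n) \<subset> H n)"

text \<open>This is the intended number only if \<open>T\<close> generates \<open>Q\<close> and \<open>Q\<close> is finite; otherwise the
  set under \<open>LEAST\<close> may be empty.\<close>

definition cayley_diam :: "('g, 'b) monoid_scheme \<Rightarrow> 'g set \<Rightarrow> nat" where
  "cayley_diam Q T = (LEAST n. \<forall>g\<in>carrier Q. \<exists>xs. length xs \<le> n \<and>
    set xs \<subseteq> T \<union> (\<lambda>x. inv\<^bsub>Q\<^esub> x) ` T \<and> g = foldr (\<otimes>\<^bsub>Q\<^esub>) xs \<one>\<^bsub>Q\<^esub>)"

definition quotient_diam :: "('g, 'b) monoid_scheme \<Rightarrow> 'g set \<Rightarrow> 'g set \<Rightarrow> nat" where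
  "quotient_diam G S N = cayley_diam (G Mod N) ((\<lambda>s. N #>\<^bsub>G\<^esub> s) ` S)"

definition uq_alpha_wrt :: "('g, 'b) monoid_scheme \<Rightarrow> 'g set \<Rightarrow> real \<Rightarrow> bool" where
  "uq_alpha_wrt G S \<alpha> \<longleftrightarrow> (\<exists>\<epsilon>>0. \<forall>N. N \<lhd> G \<and> finite_index G N \<and> N \<noteq> carrier G \<longrightarrow>
    real (quotient_diam G S N) \<ge> \<epsilon> * real (index G N) powr \<alpha>)"

text \<open>The property does not depend on the finite generating set \<open>S\<close>. With the existential quantifier,
  its negation says that the bound fails for every finite generating set.\<close>

definition uq_alpha :: "('g, 'b) monoid_scheme \<Rightarrow> real \<Rightarrow> bool" where
  "uq_alpha G \<alpha> \<longleftrightarrow> (\<exists>S. finite_generating_set G S \<and> uq_alpha_wrt G S \<alpha>)"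

definition has_uq :: "('g, 'b) monoid_scheme \<Rightarrow> bool" where
  "has_uq G \<longleftrightarrow> (\<exists>\<alpha>. 0 < \<alpha> \<and> \<alpha> \<le> 1 \<and> uq_alpha G \<alpha>)"

end

theory Submission
  imports Defs
begin

text \<open>
  The quotient of \<open>\<int>[1/k] \<rtimes> \<int>\<close> onto \<open>\<int>/(k\<^sup>n - 1) \<rtimes> \<int>/n\<close> has index exponential in \<open>n\<close>. Its diameter is
  only linear in \<open>n\<close>: writing \<open>x < k\<^sup>n\<close> in base \<open>k\<close> and evaluating by Horner's rule, with \<open>t\<close> acting
  as multiplication by \<open>k\<close>, expresses \<open>a\<^sup>x\<close> as a word of length at most \<open>(k + 1) n\<close>. No bound
  \<open>\<epsilon> [G : N]\<^sup>\<alpha>\<close> can hold along this sequence.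

  The isomorphism with the presented group rests on the normal form \<open>t\<^sup>-\<^sup>m a\<^sup>c t\<^sup>p\<close>, which is sent to
  \<open>(c / k\<^sup>m, p - m)\<close>.
\<close>

section \<open>Presented groups\<close>

definition word_class :: "('a word \<times> 'a word) set \<Rightarrow> 'a word \<Rightarrow> 'a word set" where
  "word_class R u = {v. presented_eq R u v}"

definition word_inv :: "'a word \<Rightarrow> 'a word" where
  "word_inv w = rev (map (\<lambda>(x, b). (x, \<not> b)) w)"

lemma word_class_eq_iff: "word_class R u = word_class R v \<longleftrightarrow> presented_eq R u v"
  unfolding word_class_def
  by (auto intro: presented_eq.refl presented_eq.sym presented_eq.trans)

lemma presented_eq_word_inv_append: "presented_eq R (word_inv w @ w) []"
proof (induction w)
  case Nil
  show ?case by (simp add: word_inv_def presented_eq.refl)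
next
  case (Cons l w)
  obtain x b where l: "l = (x, b)" by (cases l)
  have "presented_eq R [(x, \<not> b), (x, b)] []"
    using presented_eq.cancel[of R x "\<not> b"] by simp
  then have "presented_eq R (word_inv w @ [(x, \<not> b), (x, b)] @ w) (word_inv w @ [] @ w)"
    by (intro presented_eq.append presented_eq.refl)
  with Cons show ?case
    by (auto simp: word_inv_def l intro: presented_eq.trans)
qed

lemma carrier_presented_group: "carrier (presented_group R) = range (word_class R)"
  by (auto simp: presented_group_def quotient_def word_class_def Image_def)

lemma one_presented_group: "\<one>\<^bsub>presented_group R\<^esub> = word_class R []"
  by (simp add: presented_group_def word_class_def)

text \<open>The product in \<open>presented_group\<close> collects every word equivalent to some
  concatenation of representatives. The congruence rule \<open>append\<close> makes this a single
  class.\<close>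

lemma mult_presented_group:
  "word_class R u \<otimes>\<^bsub>presented_group R\<^esub> word_class R v = word_class R (u @ v)"
proof -
  have "presented_eq R (u @ v) w" if "presented_eq R u u'" "presented_eq R v v'"
    "presented_eq R (u' @ v') w" for u' v' w
    using that by (blast intro: presented_eq.append presented_eq.trans)
  then show ?thesis
    by (auto simp: presented_group_def word_class_def intro: presented_eq.refl)
qed

lemma group_presented_group: "group (presented_group R)"
proof (rule groupI)
  fix A assume "A \<in> carrier (presented_group R)"
  then obtain u where "A = word_class R u" by (auto simp: carrier_presented_group)
  then show "\<exists>B\<in>carrier (presented_group R). B \<otimes>\<^bsub>presented_group R\<^esub> A = \<one>\<^bsub>presented_group R\<^esub>"
    by (intro bexI[of _ "word_class R (word_inv u)"])
      (auto simp: carrier_presented_group mult_presented_group one_presented_group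
        word_class_eq_iff presented_eq_word_inv_append)
qed (auto simp: carrier_presented_group mult_presented_group one_presented_group)

lemma inv_word_class_letter:
  "inv\<^bsub>presented_group R\<^esub> (word_class R [(x, b)]) = word_class R [(x, \<not> b)]"
proof -
  interpret group "presented_group R" by (rule group_presented_group)
  have "word_class R [(x, \<not> b), (x, b)] = word_class R []"
    unfolding word_class_eq_iff using presented_eq.cancel[of R x "\<not> b"] by simp
  then show ?thesis
    by (intro inv_equality)
      (auto simp: mult_presented_group one_presented_group carrier_presented_group)
qed

lemma word_class_replicate:
  "word_class R (replicate n (x, True)) = word_class R [(x, True)] [^]\<^bsub>presented_group R\<^esub> n"
proof -
  interpret group "presented_group R" by (rule group_presented_group)
  show ?thesis
  proof (induction n)
    case (Suc n)
    have "word_class R [(x, True)] [^]\<^bsub>presented_group R\<^esub> Suc n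
      = word_class R (replicate n (x, True) @ [(x, True)])"
      by (simp add: Suc[symmetric] mult_presented_group)
    then show ?case by (simp add: replicate_append_same)
  qed (simp add: one_presented_group)
qed

lemma generate_presented_group:
  "generate (presented_group R) (range (\<lambda>x. word_class R [(x, True)]))
    = carrier (presented_group R)"
proof
  interpret group "presented_group R" by (rule group_presented_group)
  show "generate (presented_group R) (range (\<lambda>x. word_class R [(x, True)]))
      \<subseteq> carrier (presented_group R)"
    by (rule generate_incl) (auto simp: carrier_presented_group)
  have "word_class R w
      \<in> generate (presented_group R) (range (\<lambda>x. word_class R [(x, True)]))" for w
  proof (induction w)
    case Nil
    show ?case by (simp add: one_presented_group[symmetric] generate.one)
  next
    case (Cons l w)
    obtain x b where l: "l = (x, b)" by (cases l)
    have "word_class R [(x, b)]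
        \<in> generate (presented_group R) (range (\<lambda>x. word_class R [(x, True)]))"
    proof (cases b)
      case False
      then show ?thesis
        using generate.inv[of "word_class R [(x, True)]"
            "range (\<lambda>x. word_class R [(x, True)])" "presented_group R"]
        by (simp add: inv_word_class_letter)
    qed (simp add: generate.incl)
    from generate.eng[OF this Cons] show ?case
      by (simp add: mult_presented_group l)
  qed
  then show "carrier (presented_group R)
      \<subseteq> generate (presented_group R) (range (\<lambda>x. word_class R [(x, True)]))"
    by (auto simp: carrier_presented_group)
qed

section \<open>Evaluation of words and the universal property of presentations\<close>

definition word_eval :: "('h, 'b) monoid_scheme \<Rightarrow> ('a \<Rightarrow> 'h) \<Rightarrow> 'a word \<Rightarrow> 'h" where
  "word_eval H f w = foldr (\<lambda>(x, b) h. (if b then f x else inv\<^bsub>H\<^esub> (f x)) \<otimes>\<^bsub>H\<^esub> h) w \<one>\<^bsub>H\<^esub>"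

context group
begin

lemma word_eval_closed: "(\<And>x. f x \<in> carrier G) \<Longrightarrow> word_eval G f w \<in> carrier G"
  by (induction w) (auto simp: word_eval_def)

lemma word_eval_append:
  assumes "\<And>x. f x \<in> carrier G"
  shows "word_eval G f (u @ v) = word_eval G f u \<otimes> word_eval G f v"
proof (induction u)
  case (Cons l u)
  have "\<And>w. foldr (\<lambda>(x, b) h. (if b then f x else inv (f x)) \<otimes> h) w \<one> \<in> carrier G"
    using word_eval_closed[of f] assms by (simp add: word_eval_def)
  with Cons show ?case
    by (cases l) (auto simp: word_eval_def m_assoc assms)
next
  case Nil
  show ?case using word_eval_closed[of f v] assms by (simp add: word_eval_def)
qed

lemma word_eval_replicate:
  assumes "\<And>x. f x \<in> carrier G"
  shows "word_eval G f (replicate n (x, True)) = f x [^] n"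
proof (induction n)
  case (Suc n)
  then show ?case
    using nat_pow_Suc2[OF assms, of x n] by (simp add: word_eval_def)
qed (simp add: word_eval_def)

lemma word_eval_cong:
  assumes "\<And>x. f x \<in> carrier G"
    and "\<And>l r. (l, r) \<in> R \<Longrightarrow> word_eval G f l = word_eval G f r"
    and "presented_eq R u v"
  shows "word_eval G f u = word_eval G f v"
  using assms(3)
proof induction
  case (cancel x b)
  show ?case by (simp add: word_eval_def assms(1))
qed (use assms(1,2) in \<open>auto simp: word_eval_append\<close>)

text \<open>Von Dyck's theorem: an assignment of the generators that respects the relations extends
  to a homomorphism.\<close>

lemma presented_group_hom:
  assumes "\<And>x. f x \<in> carrier G"
    and "\<And>l r. (l, r) \<in> R \<Longrightarrow> word_eval G f l = word_eval G f r"
  shows "\<exists>\<phi>\<in>hom (presented_group R) G. \<forall>x. \<phi> (word_class R [(x, True)]) = f x"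
proof
  \<comment> \<open>A class is evaluated on an arbitrarily chosen word; by
    \<open>word_eval_cong\<close> the choice is immaterial.\<close>
  define \<phi> where "\<phi> A = word_eval G f (SOME w. A = word_class R w)" for A
  have \<phi>: "\<phi> (word_class R w) = word_eval G f w" for w
    using someI[of "\<lambda>v. word_class R w = word_class R v" w]
      word_eval_cong[of f R _ w] assms
    unfolding \<phi>_def by (metis word_class_eq_iff)
  show "\<forall>x. \<phi> (word_class R [(x, True)]) = f x"
    using assms(1) by (simp add: \<phi> word_eval_def)
  show "\<phi> \<in> hom (presented_group R) G"
    using assms(1)
    by (auto simp: hom_def carrier_presented_group mult_presented_group \<phi>
        word_eval_append word_eval_closed)
qed

end


section \<open>The affine model\<close>

lemma of_int_in_Z_inverted: "of_int c \<in> Z_inverted k"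
  by (auto simp: Z_inverted_def intro!: exI[of _ c] exI[of _ "0::nat"])

lemma Z_inverted_uminus: "x \<in> Z_inverted k \<Longrightarrow> - x \<in> Z_inverted k"
  unfolding Z_inverted_def by (auto, metis of_int_minus minus_divide_left)

lemma Z_inverted_mult: "x \<in> Z_inverted k \<Longrightarrow> y \<in> Z_inverted k \<Longrightarrow> x * y \<in> Z_inverted k"
  unfolding Z_inverted_def
  by clarsimp (metis of_int_mult power_add times_divide_times_eq)

context
  fixes k :: int
  assumes k0: "k \<noteq> 0"
begin

lemma Z_inverted_add:
  assumes "x \<in> Z_inverted k" "y \<in> Z_inverted k"
  shows "x + y \<in> Z_inverted k"
proof -
  obtain c m d n where "x = of_int c / of_int k ^ m" "y = of_int d / of_int k ^ n"
    using assms by (auto simp: Z_inverted_def)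
  then have "x + y = of_int (c * k ^ n + d * k ^ m) / of_int k ^ (m + n)"
    using k0 by (simp add: power_add add_frac_eq)
  then show ?thesis unfolding Z_inverted_def by blast
qed

lemma powi_in_Z_inverted: "of_int k powi i \<in> Z_inverted k"
proof (cases "i \<ge> 0")
  case True
  then show ?thesis
    using of_int_in_Z_inverted[of "k ^ nat i" k] by (simp add: power_int_def)
next
  case False
  then have "of_int k powi i = (of_int 1 / of_int k ^ nat (- i) :: rat)"
    by (simp add: power_int_def field_simps)
  then show ?thesis unfolding Z_inverted_def by blast
qed

lemma group_Z_inverted_semidirect_Z: "group (Z_inverted_semidirect_Z k)"
proof (rule groupI)
  fix g assume "g \<in> carrier (Z_inverted_semidirect_Z k)"
  then obtain x i where g: "g = (x, i)" "x \<in> Z_inverted k"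
    by (auto simp: Z_inverted_semidirect_Z_def)
  \<comment> \<open>A left inverse has the form \<open>(y, - i)\<close> and must satisfy
    \<open>y + of_int k powi (- i) * x = 0\<close>.\<close>
  then have "(- (of_int k powi (- i) * x), - i) \<in> carrier (Z_inverted_semidirect_Z k)"
    by (auto simp: Z_inverted_semidirect_Z_def Z_inverted_uminus Z_inverted_mult
        powi_in_Z_inverted)
  with g show "\<exists>h\<in>carrier (Z_inverted_semidirect_Z k).
      h \<otimes>\<^bsub>Z_inverted_semidirect_Z k\<^esub> g = \<one>\<^bsub>Z_inverted_semidirect_Z k\<^esub>"
    by (intro bexI[of _ "(- (of_int k powi (- i) * x), - i)"]) (auto simp: Z_inverted_semidirect_Z_def)
qed (use k0 in \<open>auto simp: Z_inverted_semidirect_Z_def Z_inverted_add Z_inverted_mult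
      powi_in_Z_inverted power_int_add algebra_simps
      of_int_in_Z_inverted[where c = 0, simplified]\<close>)

lemma inv_Z_inverted_semidirect_Z:
  assumes "x \<in> Z_inverted k"
  shows "inv\<^bsub>Z_inverted_semidirect_Z k\<^esub> (x, i) = (- (of_int k powi (- i) * x), - i)"
proof -
  interpret group "Z_inverted_semidirect_Z k" by (rule group_Z_inverted_semidirect_Z)
  show ?thesis
    using assms by (intro inv_equality) (auto simp: Z_inverted_semidirect_Z_def
        Z_inverted_uminus Z_inverted_mult powi_in_Z_inverted)
qed

lemma pow_Z_inverted_semidirect_Z:
  fixes n :: nat
  shows "(0, 1) [^]\<^bsub>Z_inverted_semidirect_Z k\<^esub> n = (0, int n)"
    "(1, 0) [^]\<^bsub>Z_inverted_semidirect_Z k\<^esub> n = (of_nat n, 0)"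
  by (induction n) (auto simp: nat_pow_def Z_inverted_semidirect_Z_def)

lemma int_pow_Z_inverted_semidirect_Z:
  fixes n :: int
  shows "(0, 1) [^]\<^bsub>Z_inverted_semidirect_Z k\<^esub> n = (0, n)"
    "(1, 0) [^]\<^bsub>Z_inverted_semidirect_Z k\<^esub> n = (of_int n, 0)"
proof -
  have "0 \<in> Z_inverted k" "- of_int n \<in> Z_inverted k"
    using of_int_in_Z_inverted[of 0 k] of_int_in_Z_inverted[of "- n" k] by simp_all
  then show "(0, 1) [^]\<^bsub>Z_inverted_semidirect_Z k\<^esub> n = (0, n)"
    "(1, 0) [^]\<^bsub>Z_inverted_semidirect_Z k\<^esub> n = (of_int n, 0)"
    by (auto simp: int_pow_def2 pow_Z_inverted_semidirect_Z inv_Z_inverted_semidirect_Z)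
qed

end

text \<open>The principal ideal of the ring Z[1/k] generated by \<open>m\<close>. It will be used
  with \<open>m = k ^ n - 1\<close>, where it cuts out the first coordinates of a congruence
  kernel.\<close>

definition Z_inverted_multiples :: "int \<Rightarrow> int \<Rightarrow> rat set" where
  "Z_inverted_multiples k m = (*) (of_int m) ` Z_inverted k"

lemma of_int_mult_in_Z_inverted_multiples: "of_int (m * c) \<in> Z_inverted_multiples k m"
  unfolding Z_inverted_multiples_def using of_int_in_Z_inverted[of c k] by auto

lemma Z_inverted_multiples_mult:
  "x \<in> Z_inverted_multiples k m \<Longrightarrow> y \<in> Z_inverted k \<Longrightarrow> x * y \<in> Z_inverted_multiples k m"
  unfolding Z_inverted_multiples_def by (auto simp: mult.assoc Z_inverted_mult)

lemma Z_inverted_multiples_uminus: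
  "x \<in> Z_inverted_multiples k m \<Longrightarrow> - x \<in> Z_inverted_multiples k m"
  using Z_inverted_multiples_mult[of x k m "- 1"] of_int_in_Z_inverted[of "- 1" k] by simp

lemma Z_inverted_multiples_mono:
  "m dvd m' \<Longrightarrow> Z_inverted_multiples k m' \<subseteq> Z_inverted_multiples k m"
  unfolding Z_inverted_multiples_def
  by (auto simp: mult.assoc Z_inverted_mult of_int_in_Z_inverted elim!: dvdE)

lemma Z_inverted_multiples_add:
  assumes "k \<noteq> 0" "x \<in> Z_inverted_multiples k m" "y \<in> Z_inverted_multiples k m"
  shows "x + y \<in> Z_inverted_multiples k m"
  using assms unfolding Z_inverted_multiples_def
  by (auto simp: Z_inverted_add distrib_left[symmetric])

text \<open>Clearing denominators gives \<open>j * k ^ n = m * c\<close>, and coprimality cancels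
  the power of \<open>k\<close>. Thus Z/m embeds into Z[1/k] modulo \<open>m\<close>, which later
  bounds the index from below.\<close>

lemma of_int_in_Z_inverted_multiplesD:
  assumes "k \<noteq> 0" "coprime m k" "of_int j \<in> Z_inverted_multiples k m"
  shows "m dvd j"
proof -
  obtain c n where "(of_int j :: rat) = of_int m * (of_int c / of_int k ^ n)"
    using assms(3) by (auto simp: Z_inverted_multiples_def Z_inverted_def)
  then have "(of_int (j * k ^ n) :: rat) = of_int (m * c)"
    using assms(1) by (simp add: field_simps)
  then have "m dvd j * k ^ n"
    by (metis of_int_eq_iff dvd_triv_left)
  with assms(2) show ?thesis
    by (simp add: coprime_dvd_mult_left_iff)
qed

lemma minus_one_dvd_power_minus_one: "(x - 1 :: int) dvd x ^ r - 1"
proof (induction r)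
  case (Suc r)
  have "x ^ Suc r - 1 = x * (x ^ r - 1) + (x - 1)" by (simp add: algebra_simps)
  with Suc show ?case by (metis dvd_add dvd_mult dvd_refl)
qed simp

text \<open>Since \<open>k ^ n\<close> is 1 modulo the ideal, multiplication by
  \<open>of_int k powi i\<close> is trivial on the quotient whenever \<open>n\<close> divides
  \<open>i\<close>. This is what lets Z/n act on Z/(k^n - 1).\<close>

lemma powi_minus_one_in_Z_inverted_multiples:
  assumes "k \<noteq> 0" "int n dvd i"
  shows "of_int k powi i - 1 \<in> Z_inverted_multiples k (k ^ n - 1)"
proof -
  have pos: "of_int (k ^ (n * r) - 1) \<in> Z_inverted_multiples k (k ^ n - 1)" for r
    using minus_one_dvd_power_minus_one[of "k ^ n" r]
    by (auto simp: power_mult of_int_mult_in_Z_inverted_multiples simp del: of_int_mult of_int_diff elim!: dvdE)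
  obtain q where q: "i = int n * q" using assms(2) by auto
  show ?thesis
  proof (cases "q \<ge> 0")
    case True
    with q have "i = int (n * nat q)" by simp
    with pos[of "nat q"] show ?thesis by (simp only: power_int_of_nat) simp
  next
    case False
    define r where "r = nat (- q)"
    with False q have i: "i = - int (n * r)" by simp
    \<comment> \<open>A negative exponent reduces to the positive case by multiplying with the unit
      \<open>- (of_int k powi i)\<close>.\<close>
    have "of_int (k ^ (n * r) - 1) * (- (of_int k powi i)) \<in> Z_inverted_multiples k (k ^ n - 1)"
      using pos assms(1)
      by (intro Z_inverted_multiples_mult Z_inverted_uminus powi_in_Z_inverted)
    moreover have "of_int (k ^ (n * r) - 1) * (- (of_int k powi i)) = (of_int k powi i - 1 :: rat)"
      unfolding i power_int_minus power_int_of_nat using assms(1) by (simp add: field_simps)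
    ultimately show ?thesis by metis
  qed
qed


section \<open>Balls in the word metric\<close>

text \<open>The words have the same shape as those in \<open>cayley_diam\<close>, but are evaluated
  in the group itself rather than in a quotient.\<close>

definition word_ball :: "('g, 'b) monoid_scheme \<Rightarrow> 'g set \<Rightarrow> nat \<Rightarrow> 'g set" where
  "word_ball G S n = {foldr (\<otimes>\<^bsub>G\<^esub>) xs \<one>\<^bsub>G\<^esub> | xs.
    length xs \<le> n \<and> set xs \<subseteq> S \<union> (\<lambda>x. inv\<^bsub>G\<^esub> x) ` S}"

lemma word_ballI:
  "length xs \<le> n \<Longrightarrow> set xs \<subseteq> S \<union> (\<lambda>x. inv\<^bsub>G\<^esub> x) ` S \<Longrightarrow>
    foldr (\<otimes>\<^bsub>G\<^esub>) xs \<one>\<^bsub>G\<^esub> \<in> word_ball G S n"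
  unfolding word_ball_def by blast

lemma word_ball_mono: "m \<le> n \<Longrightarrow> word_ball G S m \<subseteq> word_ball G S n"
  unfolding word_ball_def by fastforce

lemma one_in_word_ball: "\<one>\<^bsub>G\<^esub> \<in> word_ball G S n"
  using word_ballI[of "[]" n S G] by simp

context group
begin

lemma foldr_mult_closed: "set xs \<subseteq> carrier G \<Longrightarrow> foldr (\<otimes>) xs \<one> \<in> carrier G"
  by (induction xs) auto

lemma foldr_mult_append:
  "set xs \<subseteq> carrier G \<Longrightarrow> set ys \<subseteq> carrier G \<Longrightarrow>
    foldr (\<otimes>) (xs @ ys) \<one> = foldr (\<otimes>) xs \<one> \<otimes> foldr (\<otimes>) ys \<one>"
  by (induction xs) (auto simp: m_assoc foldr_mult_closed simp del: foldr_append)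

context
  fixes S assumes S: "S \<subseteq> carrier G"
begin

lemma word_ball_mult:
  assumes "g \<in> word_ball G S m" "h \<in> word_ball G S n"
  shows "g \<otimes> h \<in> word_ball G S (m + n)"
proof -
  obtain xs ys where w: "g = foldr (\<otimes>) xs \<one>" "length xs \<le> m" "set xs \<subseteq> S \<union> (\<lambda>x. inv x) ` S"
    "h = foldr (\<otimes>) ys \<one>" "length ys \<le> n" "set ys \<subseteq> S \<union> (\<lambda>x. inv x) ` S"
    using assms unfolding word_ball_def by blast
  then have "set xs \<subseteq> carrier G" "set ys \<subseteq> carrier G" using S by auto
  with w show ?thesis
    using word_ballI[of "xs @ ys" "m + n" S G] foldr_mult_append[of xs ys]
    by (simp del: foldr_append)
qed

lemma word_ball_pow: "g \<in> word_ball G S m \<Longrightarrow> g [^] (n::nat) \<in> word_ball G S (n * m)"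
proof (induction n)
  case (Suc n)
  from word_ball_mult[OF Suc.IH[OF Suc.prems] Suc.prems] show ?case by (simp add: add.commute)
qed (simp add: one_in_word_ball)

text \<open>This gives independence of the generating set: fixed elements such as \<open>a\<close>
  and \<open>t\<close> have some finite length over any generating set \<open>S\<close>.\<close>

lemma generate_in_word_ball: "g \<in> generate G S \<Longrightarrow> \<exists>n. g \<in> word_ball G S n"
proof (induction rule: generate.induct)
  case one
  show ?case by (auto simp: one_in_word_ball)
next
  case (incl h)
  then show ?case using word_ballI[of "[h]" 1 S G] S by fastforce
next
  case (inv h)
  then show ?case using word_ballI[of "[inv h]" 1 S G] S by fastforce
next
  case (eng h1 h2)
  then show ?case using word_ball_mult by blast
qed

text \<open>If every coset contains a product of at most \<open>n\<close> letters, projecting that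
  word letter by letter expresses the coset with equally many letters. So \<open>n\<close> is
  admissible for the \<open>LEAST\<close> in \<open>cayley_diam\<close> and bounds it.\<close>

lemma quotient_diam_le:
  assumes N: "N \<lhd> G"
    and cover: "\<And>g. g \<in> carrier G \<Longrightarrow> \<exists>h\<in>word_ball G S n. h \<in> N #> g"
  shows "quotient_diam G S N \<le> n"
  unfolding quotient_diam_def cayley_diam_def
proof (intro Least_le ballI)
  interpret N: normal N G by (rule N)
  interpret Q: group_hom G "G Mod N" "\<lambda>g. N #> g"
    by (intro group_hom.intro group_hom_axioms.intro N.factorgroup_is_group N.r_coset_hom_Mod)
      (rule is_group)
  fix C assume "C \<in> carrier (G Mod N)"
  then obtain g where g: "g \<in> carrier G" "C = N #> g"
    by (auto simp: FactGroup_def RCOSETS_def)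
  obtain xs where xs: "length xs \<le> n" "set xs \<subseteq> S \<union> (\<lambda>x. inv x) ` S"
      "foldr (\<otimes>) xs \<one> \<in> N #> g"
    using cover[OF g(1)] unfolding word_ball_def by blast
  have sub: "S \<union> (\<lambda>x. inv x) ` S \<subseteq> carrier G" using S by auto
  have "set xs \<subseteq> carrier G \<Longrightarrow>
      foldr (\<otimes>\<^bsub>G Mod N\<^esub>) (map (\<lambda>g. N #> g) xs) \<one>\<^bsub>G Mod N\<^esub> = N #> foldr (\<otimes>) xs \<one>"
    by (induction xs) (auto simp: foldr_mult_closed)
  then have "C = foldr (\<otimes>\<^bsub>G Mod N\<^esub>) (map (\<lambda>g. N #> g) xs) \<one>\<^bsub>G Mod N\<^esub>"
    using repr_independence[OF xs(3) g(1) N.is_subgroup] sub xs(2) g(2) by auto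
  \<comment> \<open>The projection is a homomorphism, so the image of an inverse letter is the
    inverse of the image of that letter.\<close>
  moreover have "set (map (\<lambda>g. N #> g) xs)
      \<subseteq> (\<lambda>s. N #> s) ` S \<union> (\<lambda>x. inv\<^bsub>G Mod N\<^esub> x) ` (\<lambda>s. N #> s) ` S"
    using xs(2) S by (fastforce simp: image_iff)
  ultimately show "\<exists>ys. length ys \<le> n \<and>
      set ys \<subseteq> (\<lambda>s. N #> s) ` S \<union> (\<lambda>x. inv\<^bsub>G Mod N\<^esub> x) ` (\<lambda>s. N #> s) ` S \<and>
      C = foldr (\<otimes>\<^bsub>G Mod N\<^esub>) ys \<one>\<^bsub>G Mod N\<^esub>"
    using xs(1) by (metis length_map)
qed

end

end


section \<open>Congruence quotients\<close>

text \<open>Isolates what the argument needs from the presentation: two generators, the defining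
  relation, and a homomorphism \<phi> to the affine group. That \<phi> is an isomorphism is derived,
  not assumed.\<close>

locale affine_coordinates = group G for G (structure) +
  fixes k :: int and a t :: 'a and \<phi> :: "'a \<Rightarrow> rat \<times> int"
  assumes k: "2 \<le> k"
    and a [simp]: "a \<in> carrier G" and t [simp]: "t \<in> carrier G"
    and generate: "generate G {a, t} = carrier G"
    and conj: "t \<otimes> a \<otimes> inv t = a [^] k"
    and hom: "\<phi> \<in> hom G (Z_inverted_semidirect_Z k)"
    and \<phi>_a: "\<phi> a = (1, 0)" and \<phi>_t: "\<phi> t = (0, 1)"
begin

section \<open>Commutation relations and normal forms\<close>

lemma k_nonzero: "k \<noteq> 0"
  using k by simp

sublocale \<phi>: group_hom G "Z_inverted_semidirect_Z k" \<phi>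
  by (intro group_hom.intro group_hom_axioms.intro hom
      group_Z_inverted_semidirect_Z k_nonzero is_group)

declare \<phi>.hom_mult [simp del] \<phi>.hom_inv [simp del]

text \<open>Conjugation by \<open>t\<close> is an endomorphism, so the relation for \<open>a\<close>
  extends to all integer powers of \<open>a\<close>.\<close>

lemma t_conj_pow: "t \<otimes> a [^] (c::int) = a [^] (k * c) \<otimes> t"
proof -
  have "(\<lambda>x. t \<otimes> x \<otimes> inv t) \<in> hom G G"
    by (auto simp: hom_def m_assoc) (simp add: m_assoc[symmetric])
  then have "t \<otimes> a [^] c \<otimes> inv t = (a [^] k) [^] c"
    using hom_int_pow[of "\<lambda>x. t \<otimes> x \<otimes> inv t" G G a c] conj by (simp add: is_group)
  then have "t \<otimes> a [^] c \<otimes> inv t = a [^] (k * c)" by (simp add: int_pow_pow)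
  then have "t \<otimes> a [^] c \<otimes> inv t \<otimes> t = a [^] (k * c) \<otimes> t" by simp
  then show ?thesis by (simp add: m_assoc)
qed

lemma t_pow_conj_pow: "t [^] (m::nat) \<otimes> a [^] (c::int) = a [^] (k ^ m * c) \<otimes> t [^] m"
proof (induction m arbitrary: c)
  case (Suc m)
  have "t [^] Suc m \<otimes> a [^] c = t [^] m \<otimes> (t \<otimes> a [^] c)" by (simp add: m_assoc)
  also have "\<dots> = t [^] m \<otimes> a [^] (k * c) \<otimes> t" by (simp add: t_conj_pow m_assoc)
  also have "\<dots> = a [^] (k ^ Suc m * c) \<otimes> t [^] Suc m"
    by (simp add: Suc m_assoc mult.assoc mult.left_commute)
  finally show ?case .
qed simp

text \<open>Inverse powers of \<open>t\<close> move to the left by multiplying the exponent of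
  \<open>a\<close>; moving them to the right would require division by \<open>k ^ m\<close>. Hence
  the inverse power stands first in \<open>normal_form\<close>.\<close>

lemma a_pow_inv_t_pow:
  "a [^] (c::int) \<otimes> inv (t [^] (m::nat)) = inv (t [^] m) \<otimes> a [^] (k ^ m * c)"
proof -
  have "t [^] m \<otimes> (a [^] c \<otimes> inv (t [^] m)) = a [^] (k ^ m * c)"
    by (simp add: m_assoc[symmetric] t_pow_conj_pow) (simp add: m_assoc)
  then show ?thesis
    by (metis a t inv_closed inv_solve_left int_pow_closed nat_pow_closed m_closed)
qed

text \<open>The encoding is redundant: \<open>(m, c, p)\<close> and
  \<open>(m + 1, k * c, p + 1)\<close> give the same element, just as \<open>c / k ^ m\<close> is
  not a unique fraction.\<close>

definition normal_form :: "nat \<Rightarrow> int \<Rightarrow> int \<Rightarrow> 'a" where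
  "normal_form m c p = inv (t [^] m) \<otimes> a [^] c \<otimes> t [^] p"

lemma normal_form_closed [simp]: "normal_form m c p \<in> carrier G"
  by (simp add: normal_form_def)

lemma a_pow_mult_normal_form: "a [^] (e::int) \<otimes> normal_form m c p = normal_form m (k ^ m * e + c) p"
proof -
  have "a [^] e \<otimes> normal_form m c p = (a [^] e \<otimes> inv (t [^] m)) \<otimes> a [^] c \<otimes> t [^] p"
    by (simp add: normal_form_def m_assoc)
  then show ?thesis
    by (simp add: a_pow_inv_t_pow normal_form_def m_assoc int_pow_mult)
qed

lemma inv_t_mult_normal_form: "inv t \<otimes> normal_form m c p = normal_form (Suc m) c p"
  by (simp add: normal_form_def m_assoc inv_mult_group)

lemma t_mult_normal_form_Suc: "t \<otimes> normal_form (Suc m) c p = normal_form m c p"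
  unfolding inv_t_mult_normal_form[symmetric] by (simp add: m_assoc[symmetric])

lemma t_mult_normal_form_0: "t \<otimes> normal_form 0 c p = normal_form 0 (k * c) (1 + p)"
proof -
  have "t \<otimes> normal_form 0 c p = (t \<otimes> a [^] c) \<otimes> t [^] p"
    by (simp add: normal_form_def m_assoc)
  then show ?thesis
    by (simp add: t_conj_pow normal_form_def m_assoc int_pow_mult)
qed

lemma ex_normal_form:
  assumes "g \<in> carrier G"
  shows "\<exists>m c p. g = normal_form m c p"
proof -
  have "g \<in> generate G {a, t}" using assms generate by simp
  \<comment> \<open>Left multiplication by a generator or its inverse preserves normal forms. The
    claim is stated for an arbitrary right factor so that the product case can apply both induction
    hypotheses in succession.\<close>
  then have "\<exists>m' c' p'. g \<otimes> normal_form m c p = normal_form m' c' p'" for m c p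
  proof (induction arbitrary: m c p rule: generate.induct)
    case one
    show ?case by auto
  next
    case (incl h)
    moreover have "a \<otimes> normal_form m c p = normal_form m (k ^ m + c) p"
      using a_pow_mult_normal_form[of 1 m c p] by simp
    \<comment> \<open>For positive \<open>m\<close> the letter \<open>t\<close> cancels against
      \<open>inv (t [^] m)\<close>; for \<open>m = 0\<close> it passes through the power of
      \<open>a\<close>.\<close>
    moreover have "\<exists>m' c' p'. t \<otimes> normal_form m c p = normal_form m' c' p'"
      by (cases m) (use t_mult_normal_form_0 t_mult_normal_form_Suc in blast)+
    ultimately show ?case by blast
  next
    case (inv h)
    moreover have "inv a \<otimes> normal_form m c p = normal_form m (c - k ^ m) p"
      using a_pow_mult_normal_form[of "-1" m c p] by (simp add: int_pow_neg)
    ultimately show ?case using inv_t_mult_normal_form by blast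
  next
    case (eng h1 h2)
    then have "h1 \<in> carrier G" "h2 \<in> carrier G" using generate by auto
    with eng.IH show ?case by (metis m_assoc normal_form_closed)
  qed
  from this[of 0 0 0] assms show ?thesis by (simp add: normal_form_def)
qed

section \<open>Coordinates of group elements and the isomorphism with the affine group\<close>

lemma \<phi>_a_pow: "\<phi> (a [^] (c::int)) = (of_int c, 0)"
  using \<phi>.hom_int_pow[OF a, of c]
  by (simp add: \<phi>_a int_pow_Z_inverted_semidirect_Z k_nonzero)

lemma \<phi>_t_pow: "\<phi> (t [^] (i::int)) = (0, i)"
  using \<phi>.hom_int_pow[OF t, of i]
  by (simp add: \<phi>_t int_pow_Z_inverted_semidirect_Z k_nonzero)

lemma \<phi>_mult:
  assumes "g \<in> carrier G" "h \<in> carrier G"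
  shows "fst (\<phi> (g \<otimes> h)) = fst (\<phi> g) + of_int k powi snd (\<phi> g) * fst (\<phi> h)"
    and "snd (\<phi> (g \<otimes> h)) = snd (\<phi> g) + snd (\<phi> h)"
  using \<phi>.hom_mult[OF assms] by (auto simp: Z_inverted_semidirect_Z_def split: prod.splits)

lemma fst_\<phi>: "g \<in> carrier G \<Longrightarrow> fst (\<phi> g) \<in> Z_inverted k"
  using \<phi>.hom_closed[of g] by (auto simp: Z_inverted_semidirect_Z_def)

lemma \<phi>_inv:
  assumes "g \<in> carrier G"
  shows "fst (\<phi> (inv g)) = - (of_int k powi (- snd (\<phi> g)) * fst (\<phi> g))"
    and "snd (\<phi> (inv g)) = - snd (\<phi> g)"
  using \<phi>.hom_inv[OF assms] inv_Z_inverted_semidirect_Z[OF k_nonzero fst_\<phi>[OF assms], of "snd (\<phi> g)"]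
  by simp_all

lemma \<phi>_normal_form: "\<phi> (normal_form m c p) = (of_int c / of_int k ^ m, p - int m)"
proof -
  have "\<phi> (t [^] m) = (0, int m)" using \<phi>_t_pow[of "int m"] by (simp add: int_pow_int)
  then show ?thesis
    using k_nonzero
    by (intro prod_eqI) (simp_all add: normal_form_def \<phi>_mult \<phi>_inv \<phi>_a_pow \<phi>_t_pow
        power_int_minus field_simps)
qed

text \<open>Both halves are read off from \<open>\<phi>_normal_form\<close>: a normal form in the
  kernel has \<open>c = 0\<close> and \<open>p = int m\<close>, so it collapses to the identity, and
  the pair \<open>(c / k ^ m, i)\<close> is hit by taking \<open>p = i + int m\<close>.\<close>

lemma \<phi>_iso: "\<phi> \<in> iso G (Z_inverted_semidirect_Z k)"
  unfolding iso_kernel_image[OF is_group \<phi>.H.is_group]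
proof (intro conjI hom)
  have "g = \<one>" if "g \<in> carrier G" "\<phi> g = (0, 0)" for g
  proof -
    obtain m c p where g: "g = normal_form m c p" using ex_normal_form \<open>g \<in> carrier G\<close> by blast
    with that(2) have "c = 0" "p = int m" using k_nonzero by (auto simp: \<phi>_normal_form)
    with g show ?thesis by (simp add: normal_form_def int_pow_int)
  qed
  moreover have "\<phi> \<one> = (0, 0)"
    using \<phi>.hom_one by (simp add: Z_inverted_semidirect_Z_def)
  ultimately show "kernel G (Z_inverted_semidirect_Z k) \<phi> = {\<one>}"
    by (auto simp: kernel_def Z_inverted_semidirect_Z_def)
  have "(of_int c / of_int k ^ m, i) \<in> \<phi> ` carrier G" for c m i
    using \<phi>_normal_form[of m c "i + int m"]
    by (intro image_eqI[of _ _ "normal_form m c (i + int m)"]) auto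
  then have "carrier (Z_inverted_semidirect_Z k) \<subseteq> \<phi> ` carrier G"
    by (auto simp: Z_inverted_semidirect_Z_def Z_inverted_def)
  then show "\<phi> ` carrier G = carrier (Z_inverted_semidirect_Z k)"
    using \<phi>.hom_closed by blast
qed

section \<open>Congruence subgroups, their cosets and their index\<close>

text \<open>The kernel of the map onto \<open>\<int>/(k\<^sup>n - 1) \<rtimes> \<int>/n\<close>.\<close>

definition congruence_subgroup :: "nat \<Rightarrow> 'a set" where
  "congruence_subgroup n =
    {g \<in> carrier G. fst (\<phi> g) \<in> Z_inverted_multiples k (k ^ n - 1) \<and> int n dvd snd (\<phi> g)}"

lemma powi_minus_one_mult:
  assumes "int n dvd i" "x \<in> Z_inverted k"
  shows "(of_int k powi i - 1) * x \<in> Z_inverted_multiples k (k ^ n - 1)"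
  using assms k_nonzero
  by (intro Z_inverted_multiples_mult powi_minus_one_in_Z_inverted_multiples)

lemma powi_mult_multiples:
  "x \<in> Z_inverted_multiples k m \<Longrightarrow> of_int k powi i * x \<in> Z_inverted_multiples k m"
  using Z_inverted_multiples_mult[OF _ powi_in_Z_inverted[OF k_nonzero]]
  by (metis mult.commute)

lemma subgroup_congruence_subgroup: "subgroup (congruence_subgroup n) G"
proof (rule subgroupI)
  have "0 \<in> Z_inverted_multiples k (k ^ n - 1)"
    using of_int_mult_in_Z_inverted_multiples[of _ 0] by simp
  then have "\<one> \<in> congruence_subgroup n"
    using \<phi>.hom_one by (simp add: congruence_subgroup_def Z_inverted_semidirect_Z_def)
  then show "congruence_subgroup n \<noteq> {}" by blast
qed (auto simp: congruence_subgroup_def \<phi>_mult \<phi>_inv Z_inverted_multiples_add k_nonzero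
    Z_inverted_multiples_uminus powi_mult_multiples)

lemma normal_congruence_subgroup: "congruence_subgroup n \<lhd> G"
  unfolding normal_inv_iff
proof (intro conjI ballI subgroup_congruence_subgroup)
  fix g h assume g: "g \<in> carrier G" and h: "h \<in> congruence_subgroup n"
  then have hG: "h \<in> carrier G" and hm: "fst (\<phi> h) \<in> Z_inverted_multiples k (k ^ n - 1)"
    and hd: "int n dvd snd (\<phi> h)" by (auto simp: congruence_subgroup_def)
  \<comment> \<open>Both summands lie in the ideal: the first is a multiple of
    \<open>fst (\<phi> h)\<close>, the second has a factor
    \<open>of_int k powi snd (\<phi> h) - 1\<close> whose exponent is divisible by
    \<open>n\<close>.\<close>
  have "fst (\<phi> (g \<otimes> h \<otimes> inv g)) = of_int k powi snd (\<phi> g) * fst (\<phi> h)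
      + - ((of_int k powi snd (\<phi> h) - 1) * fst (\<phi> g))"
    using g hG k_nonzero
    by (simp add: \<phi>_mult \<phi>_inv power_int_add power_int_minus field_simps)
  also have "\<dots> \<in> Z_inverted_multiples k (k ^ n - 1)"
    using hm hd g by (intro Z_inverted_multiples_add Z_inverted_multiples_uminus
        powi_minus_one_mult powi_mult_multiples k_nonzero fst_\<phi>)
  finally show "g \<otimes> h \<otimes> inv g \<in> congruence_subgroup n"
    using g hG hd by (simp add: congruence_subgroup_def \<phi>_mult \<phi>_inv)
qed

text \<open>The first coordinate of \<open>h \<otimes> inv g\<close> carries a twist by a power of
  \<open>k\<close>. That twist is trivial modulo the ideal once \<open>n\<close> divides the
  exponent, so lying in the same coset becomes congruence in each coordinate.\<close>

lemma in_r_coset_congruence_subgroup_iff: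
  assumes "g \<in> carrier G" "h \<in> carrier G"
  shows "h \<in> congruence_subgroup n #> g \<longleftrightarrow>
    fst (\<phi> h) - fst (\<phi> g) \<in> Z_inverted_multiples k (k ^ n - 1) \<and> int n dvd snd (\<phi> h) - snd (\<phi> g)"
proof -
  let ?i = "snd (\<phi> h) - snd (\<phi> g)" and ?J = "Z_inverted_multiples k (k ^ n - 1)"
  have eq: "fst (\<phi> (h \<otimes> inv g)) = fst (\<phi> h) - of_int k powi ?i * fst (\<phi> g)"
    using assms k_nonzero by (simp add: \<phi>_mult \<phi>_inv power_int_diff power_int_minus field_simps)
  have "fst (\<phi> (h \<otimes> inv g)) \<in> ?J \<longleftrightarrow> fst (\<phi> h) - fst (\<phi> g) \<in> ?J" if "int n dvd ?i"
  proof -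
    have *: "(of_int k powi ?i - 1) * fst (\<phi> g) \<in> ?J"
      using that assms by (intro powi_minus_one_mult fst_\<phi>)
    show ?thesis
      using Z_inverted_multiples_add[OF k_nonzero _ *, of "fst (\<phi> (h \<otimes> inv g))"]
        Z_inverted_multiples_add[OF k_nonzero _ Z_inverted_multiples_uminus[OF *], of "fst (\<phi> h) - fst (\<phi> g)"]
      unfolding eq by (auto simp: algebra_simps)
  qed
  then show ?thesis
    using subgroup.rcos_module[OF subgroup_congruence_subgroup is_group assms, of n]
      assms by (auto simp: congruence_subgroup_def \<phi>_mult \<phi>_inv)
qed

lemma ex_coset_representative:
  assumes "g \<in> carrier G" "n \<ge> 1"
  shows "\<exists>x<nat (k ^ n). \<exists>i<n. a [^] x \<otimes> t [^] i \<in> congruence_subgroup n #> g"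
proof -
  obtain m c p where g: "g = normal_form m c p" using ex_normal_form assms(1) by blast
  define M where "M = k ^ n - 1"
  have "k ^ 1 \<le> k ^ n" using k assms(2) by (intro power_increasing) auto
  then have M: "M > 0" using k by (simp add: M_def)
  \<comment> \<open>Modulo \<open>k ^ n - 1\<close> the inverse of \<open>k ^ m\<close> is
    \<open>k ^ (m * (n - 1))\<close>, so the fraction \<open>c / k ^ m\<close> is congruent to the
    integer \<open>c'\<close>.\<close>
  define c' where "c' = c * k ^ (m * (n - 1))"
  define x where "x = nat (c' mod M)"
  define i where "i = nat ((p - int m) mod int n)"
  have x: "int x = c' mod M" and i: "int i = (p - int m) mod int n"
    using M assms(2) by (auto simp: x_def i_def)
  \<comment> \<open>The slightly weaker bound \<open>k ^ n\<close> in place of \<open>M\<close> says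
    that \<open>x\<close> has at most \<open>n\<close> digits in base \<open>k\<close>, as the
    Horner argument requires.\<close>
  have "int x < k ^ n" using pos_mod_bound[OF M, of c'] unfolding x by (simp add: M_def)
  then have 1: "x < nat (k ^ n)" by simp
  have "int i < int n" unfolding i using assms(2) by (intro pos_mod_bound) simp
  then have 2: "i < n" by simp
  have "\<phi> (a [^] x \<otimes> t [^] i) = (of_nat x, int i)"
    using \<phi>_a_pow[of "int x"] \<phi>_t_pow[of "int i"]
    by (intro prod_eqI) (simp_all add: \<phi>_mult int_pow_int)
  moreover have "of_nat x - of_int c / of_int k ^ m \<in> Z_inverted_multiples k M"
  proof -
    have "int x - c' = M * (- (c' div M))"
      unfolding x by (simp add: minus_div_mult_eq_mod[symmetric] algebra_simps)
    then have "of_int (int x - c') \<in> Z_inverted_multiples k M"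
      by (metis of_int_mult_in_Z_inverted_multiples)
    moreover have "(of_int k powi (int (n * m)) - 1) * (of_int c / of_int k ^ m)
        \<in> Z_inverted_multiples k M"
      unfolding M_def by (intro powi_minus_one_mult) (auto simp: Z_inverted_def)
    moreover have "n * m = m * (n - 1) + m"
      using assms(2) by (cases n) auto
    then have "(of_int k powi (int (n * m)) - 1) * (of_int c / of_int k ^ m)
        = (of_int c' - of_int c / of_int k ^ m :: rat)"
      unfolding power_int_of_nat c'_def using k_nonzero by (simp add: power_add field_simps)
    ultimately show ?thesis
      using Z_inverted_multiples_add[OF k_nonzero, of "of_int (int x - c')" M
          "of_int c' - of_int c / of_int k ^ m"] by simp
  qed
  moreover have "int n dvd int i - (p - int m)"
    unfolding i by (metis dvd_minus_mod dvd_diff_commute)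
  ultimately have "a [^] x \<otimes> t [^] i \<in> congruence_subgroup n #> g"
    using assms(1) by (simp add: in_r_coset_congruence_subgroup_iff g \<phi>_normal_form M_def)
  with 1 2 show ?thesis by blast
qed

lemma finite_index_congruence_subgroup:
  assumes "n \<ge> 1"
  shows "finite_index G (congruence_subgroup n)"
proof -
  have "rcosets (congruence_subgroup n) \<subseteq>
      (\<lambda>(x, i). congruence_subgroup n #> (a [^] x \<otimes> t [^] i)) ` ({..<nat (k ^ n)} \<times> {..<n})"
  proof
    fix C assume "C \<in> rcosets (congruence_subgroup n)"
    then obtain g where g: "g \<in> carrier G" "C = congruence_subgroup n #> g"
      by (auto simp: RCOSETS_def)
    obtain x i where "x < nat (k ^ n)" "i < n" "a [^] x \<otimes> t [^] i \<in> congruence_subgroup n #> g"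
      using ex_coset_representative[OF g(1) assms] by blast
    then show "C \<in> (\<lambda>(x, i). congruence_subgroup n #> (a [^] x \<otimes> t [^] i)) ` ({..<nat (k ^ n)} \<times> {..<n})"
      using repr_independence[OF _ g(1) subgroup_congruence_subgroup] g(2)
      by (intro image_eqI[of _ _ "(x, i)"]) auto
  qed
  then show ?thesis unfolding finite_index_def by (rule finite_subset) simp
qed

text \<open>The powers of \<open>a\<close> with exponents in \<open>{0..<M}\<close> lie in distinct
  cosets. The further factor \<open>n\<close> from the powers of \<open>t\<close> is dropped, as
  exponential growth is enough.\<close>

lemma index_congruence_subgroup_ge:
  assumes "n \<ge> 1"
  shows "nat (k ^ n - 1) \<le> index G (congruence_subgroup n)"
proof -
  define M where "M = k ^ n - 1"
  have "coprime M k"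
    using coprime_diff_one_left[of "k ^ n"] assms by (simp add: M_def)
  have "inj_on (\<lambda>x. congruence_subgroup n #> a [^] x) {0..<M}"
  proof (rule inj_onI)
    fix x y assume xy: "x \<in> {0..<M}" "y \<in> {0..<M}"
      and "congruence_subgroup n #> a [^] x = congruence_subgroup n #> a [^] y"
    then have "a [^] y \<in> congruence_subgroup n #> a [^] x"
      by (intro repr_independenceD subgroup_congruence_subgroup) auto
    then have "of_int (y - x) \<in> Z_inverted_multiples k M"
      by (simp add: in_r_coset_congruence_subgroup_iff \<phi>_a_pow M_def)
    then have "M dvd y - x"
      by (intro of_int_in_Z_inverted_multiplesD[OF k_nonzero \<open>coprime M k\<close>])
    then have "y mod M = x mod M" by (simp add: mod_eq_dvd_iff)
    with xy show "x = y" by simp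
  qed
  moreover have "(\<lambda>x. congruence_subgroup n #> a [^] x) ` {0..<M} \<subseteq> rcosets (congruence_subgroup n)"
    by (auto intro!: rcosetsI simp: congruence_subgroup_def)
  ultimately have "card {0..<M} \<le> card (rcosets (congruence_subgroup n))"
    using finite_index_congruence_subgroup[OF assms]
    unfolding finite_index_def by (rule card_inj_on_le)
  then show ?thesis by (simp add: M_def index_def)
qed

section \<open>Linear diameter and failure of the u.q. property\<close>

text \<open>One Horner step: \<open>a\<^sup>d\<^sup>+\<^sup>k\<^sup>q = a\<^sup>d t a\<^sup>q t\<inverse>\<close> with \<open>d < k\<close>.\<close>

lemma a_pow_in_word_ball:
  assumes "S \<subseteq> carrier G" "{a, t, inv t} \<subseteq> word_ball G S L" "x < nat (k ^ n)"
  shows "a [^] x \<in> word_ball G S (n * ((nat k + 1) * L))"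
  using assms(3)
proof (induction n arbitrary: x)
  case 0
  then show ?case by (simp add: one_in_word_ball)
next
  case (Suc n)
  define d q where "d = x mod nat k" and "q = x div nat k"
  have k': "nat k > 0" "int (nat k) = k" using k by auto
  have "x < nat (k ^ n) * nat k" 
    using Suc.prems k by (simp add: nat_mult_distrib mult.commute)
  then have "q < nat (k ^ n)" unfolding q_def by (rule less_mult_imp_div_less)
  from Suc.IH[OF this] have q: "a [^] q \<in> word_ball G S (n * ((nat k + 1) * L))" .
  have "d \<le> nat k - 1" using mod_less_divisor[OF k'(1), of x] by (simp add: d_def)
  then have "a [^] d \<in> word_ball G S ((nat k - 1) * L)"
    using word_ball_pow[OF assms(1), of a L d] assms(2) word_ball_mono[of "d * L" "(nat k - 1) * L" G S]
    by auto
  moreover have "t \<in> word_ball G S L" "inv t \<in> word_ball G S L" using assms(2) by auto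
  ultimately have "a [^] d \<otimes> (t \<otimes> a [^] q \<otimes> inv t)
      \<in> word_ball G S ((nat k - 1) * L + (L + n * ((nat k + 1) * L) + L))"
    using q by (intro word_ball_mult assms(1))
  \<comment> \<open>One digit costs at most \<open>k - 1\<close> letters \<open>a\<close>, one
    \<open>t\<close> and one \<open>inv t\<close>, that is \<open>k + 1\<close> letters of length at
    most \<open>L\<close> over \<open>S\<close>.\<close>
  moreover have "(nat k - 1) * L + (L + n * ((nat k + 1) * L) + L) = Suc n * ((nat k + 1) * L)"
    using k'(1) by (cases "nat k") (simp_all add: algebra_simps del: Suc_nat_eq_nat_zadd1)
  moreover have "t \<otimes> a [^] q \<otimes> inv t = a [^] (nat k * q)"
  proof -
    have "t \<otimes> a [^] int q = a [^] int (nat k * q) \<otimes> t"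
      using t_conj_pow[of "int q"] k'(2) by simp
    then show ?thesis by (simp only: int_pow_int) (simp add: m_assoc)
  qed
  moreover have "a [^] d \<otimes> a [^] (nat k * q) = a [^] x"
    by (simp add: nat_pow_mult d_def q_def)
  ultimately show ?case by metis
qed

text \<open>Each coset has a representative \<open>a [^] x \<otimes> t [^] i\<close>. Horner's rule
  bounds the first factor, and \<open>i < n\<close> adds at most \<open>n * L\<close> for the
  second.\<close>

lemma quotient_diam_congruence_subgroup_le:
  assumes "S \<subseteq> carrier G" "{a, t, inv t} \<subseteq> word_ball G S L" "n \<ge> 1"
  shows "quotient_diam G S (congruence_subgroup n) \<le> n * ((nat k + 2) * L)"
proof (rule quotient_diam_le[OF assms(1) normal_congruence_subgroup])
  fix g assume "g \<in> carrier G"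
  then obtain x i where xi: "x < nat (k ^ n)" "i < n" "a [^] x \<otimes> t [^] i \<in> congruence_subgroup n #> g"
    using ex_coset_representative assms(3) by blast
  have "t [^] i \<in> word_ball G S (n * L)"
    using word_ball_pow[OF assms(1), of t L i] assms(2) xi(2) word_ball_mono[of "i * L" "n * L" G S]
    by auto
  then have "a [^] x \<otimes> t [^] i \<in> word_ball G S (n * ((nat k + 1) * L) + n * L)"
    by (intro word_ball_mult a_pow_in_word_ball assms xi(1))
  then show "\<exists>h\<in>word_ball G S (n * ((nat k + 2) * L)). h \<in> congruence_subgroup n #> g"
    using xi(3) by (auto simp: algebra_simps)
qed

lemma not_has_uq: "\<not> has_uq G"
proof
  assume "has_uq G"
  then obtain \<alpha> S \<epsilon> where \<alpha>: "0 < \<alpha>" and S: "finite_generating_set G S" and "0 < (\<epsilon>::real)"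
    and uq: "\<And>N. \<lbrakk>N \<lhd> G; finite_index G N; N \<noteq> carrier G\<rbrakk> \<Longrightarrow>
      \<epsilon> * real (index G N) powr \<alpha> \<le> real (quotient_diam G S N)"
    unfolding has_uq_def uq_alpha_def uq_alpha_wrt_def by blast
  have SG: "S \<subseteq> carrier G" and "generate G S = carrier G"
    using S by (auto simp: finite_generating_set_def)
  then obtain l1 l2 l3 where "a \<in> word_ball G S l1" "t \<in> word_ball G S l2" "inv t \<in> word_ball G S l3"
    using generate_in_word_ball[OF SG] by (metis a t inv_closed)
  then have L: "{a, t, inv t} \<subseteq> word_ball G S (l1 + l2 + l3)"
    using word_ball_mono[of l1 "l1 + l2 + l3" G S] word_ball_mono[of l2 "l1 + l2 + l3" G S]
      word_ball_mono[of l3 "l1 + l2 + l3" G S] by auto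
  \<comment> \<open>The summand 1 makes \<open>C\<close> positive, so that it can be divided
    by.\<close>
  define C where "C = real ((nat k + 2) * (l1 + l2 + l3)) + 1"
  define b where "b = 2 powr (- \<alpha>)"
  have "C > 0" by (simp add: C_def add_nonneg_pos)
  \<comment> \<open>The u.q. inequality is applied to level \<open>Suc n\<close>, where the index is
    at least \<open>2 ^ n\<close>. Dividing by the exponential term leaves a right-hand side that
    tends to 0.\<close>
  have bound: "\<epsilon> / C \<le> real (Suc n) * b ^ n" if "n \<ge> 1" for n
  proof -
    define N where "N = congruence_subgroup (Suc n)"
    have "2 * 2 ^ n \<le> k ^ Suc n" using power_mono[of 2 k "Suc n"] k by simp
    then have "(2::int) ^ n \<le> k ^ Suc n - 1" using one_le_power[of "2::int" n] by linarith
    then have "2 ^ n \<le> nat (k ^ Suc n - 1)" by (simp add: le_nat_iff)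
    then have "2 ^ n \<le> index G N"
      using index_congruence_subgroup_ge[of "Suc n"] unfolding N_def by linarith
    then have "2 ^ n \<le> real (index G N)" by (metis of_nat_le_iff of_nat_numeral of_nat_power)
    then have "(2 ^ n) powr \<alpha> \<le> real (index G N) powr \<alpha>" using \<alpha> by (intro powr_mono2) auto
    then have "\<epsilon> * (2 ^ n) powr \<alpha> \<le> \<epsilon> * real (index G N) powr \<alpha>"
      using \<open>\<epsilon> > 0\<close> by simp
    \<comment> \<open>Properness uses \<open>n \<ge> 1\<close>: the second coordinate of
      \<open>t\<close> is 1, which \<open>Suc n\<close> does not divide.\<close>
    also have "N \<noteq> carrier G"
    proof
      assume "N = carrier G"
      moreover have "snd (\<phi> t) = 1" by (simp add: \<phi>_t)
      ultimately have "int (Suc n) dvd 1"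
        using t unfolding N_def congruence_subgroup_def by (metis (lifting) mem_Collect_eq)
      with that show False by simp
    qed
    then have "\<epsilon> * real (index G N) powr \<alpha> \<le> real (quotient_diam G S N)"
      unfolding N_def by (intro uq normal_congruence_subgroup finite_index_congruence_subgroup) auto
    also have "quotient_diam G S N \<le> Suc n * ((nat k + 2) * (l1 + l2 + l3))"
      unfolding N_def by (rule quotient_diam_congruence_subgroup_le[OF SG L]) simp
    then have "real (quotient_diam G S N) \<le> real (Suc n) * real ((nat k + 2) * (l1 + l2 + l3))"
      by (metis of_nat_le_iff of_nat_mult)
    also have "\<dots> \<le> real (Suc n) * C" by (simp add: C_def)
    also have "(2 ^ n) powr \<alpha> = inverse (b ^ n)"
      by (simp add: b_def powr_minus powr_power powr_powr mult.commute power_inverse flip: powr_realpow)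
    finally show ?thesis
      using \<open>C > 0\<close> by (simp add: field_simps b_def)
  qed
  have "b > 0" "b < 1" using \<alpha> powr_less_mono[of "- \<alpha>" 0 2] by (auto simp: b_def)
  then have "(\<lambda>n. real n * b ^ n + b ^ n) \<longlonglongrightarrow> 0 + 0"
    by (intro tendsto_add powser_times_n_limit_0 LIMSEQ_power_zero) auto
  then have "(\<lambda>n. real (Suc n) * b ^ n) \<longlonglongrightarrow> 0" by (simp add: algebra_simps)
  then have "\<epsilon> / C \<le> 0"
    by (rule LIMSEQ_le_const) (use bound in blast)
  with \<open>\<epsilon> > 0\<close> \<open>C > 0\<close> show False by (simp add: field_simps)
qed

text \<open>The powers of \<open>t\<close> are separated by their second coordinate, so the group is
  infinite. The levels \<open>2 ^ n\<close> divide one another, which makes the congruence subgroups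
  nested; \<open>t [^] (2 ^ n)\<close> witnesses that each inclusion is strict.\<close>

lemma uq_setting: "uq_setting G"
  unfolding uq_setting_def
proof (intro conjI)
  show "group G" by (rule is_group)
  have "inj (\<lambda>i::int. t [^] i)"
    using \<phi>_t_pow by (intro injI) (metis prod.inject)
  then have "infinite (range (\<lambda>i::int. t [^] i))"
    using finite_imageD infinite_UNIV_int by blast
  then show "infinite (carrier G)"
    by (rule contrapos_nn) (auto intro: finite_subset[rotated])
  show "\<exists>S. finite_generating_set G S"
    using generate by (intro exI[of _ "{a, t}"]) (auto simp: finite_generating_set_def)
  have "congruence_subgroup (2 ^ Suc n) \<subset> congruence_subgroup (2 ^ n)" for n
  proof
    have "k ^ (2 ^ n) - 1 dvd k ^ (2 ^ Suc n) - 1"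
      using minus_one_dvd_power_minus_one[of "k ^ (2 ^ n)" 2] by (simp add: power_mult[symmetric] mult.commute)
    from Z_inverted_multiples_mono[OF this, of k]
    show "congruence_subgroup (2 ^ Suc n) \<subseteq> congruence_subgroup (2 ^ n)"
      by (auto simp: congruence_subgroup_def intro: dvd_mult_right)
    have "0 \<in> Z_inverted_multiples k m" for m
      using of_int_mult_in_Z_inverted_multiples[of m 0] by simp
    then have "t [^] (2 ^ n :: int) \<in> congruence_subgroup (2 ^ n)"
      by (simp add: congruence_subgroup_def \<phi>_t_pow)
    moreover have "t [^] (2 ^ n :: int) \<notin> congruence_subgroup (2 ^ Suc n)"
      by (auto simp: congruence_subgroup_def \<phi>_t_pow dest: zdvd_imp_le)
    ultimately show "congruence_subgroup (2 ^ Suc n) \<noteq> congruence_subgroup (2 ^ n)" by blast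
  qed
  then show "\<exists>H. \<forall>n. subgroup (H n) G \<and> finite_index G (H n) \<and> H (Suc n) \<subset> H n"
    by (intro exI[of _ "\<lambda>n. congruence_subgroup (2 ^ n)"])
      (auto simp: subgroup_congruence_subgroup finite_index_congruence_subgroup)
qed

end


section \<open>Baumslag--Solitar groups\<close>

text \<open>The homomorphism comes from the universal property, since in the affine group both sides
  of the defining relation evaluate to \<open>(of_int k, 0)\<close>.\<close>

lemma BS_affine_coordinates:
  fixes k :: int
  assumes k: "k \<ge> 2"
  obtains a t \<phi> where "affine_coordinates (BS 1 k) k a t \<phi>"
proof -
  define R where "R = {(gen_pow Gen_t 1 @ gen_pow Gen_a 1 @ gen_pow Gen_t (- 1), gen_pow Gen_a k)}"
  have BS: "BS 1 k = presented_group R" by (simp add: BS_def R_def)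
  define gen where "gen x = word_class R [(x, True)]" for x
  \<comment> \<open>Viewed as affine maps, \<open>a\<close> is translation by 1 and \<open>t\<close>
    is multiplication by \<open>k\<close>.\<close>
  define f where "f x = (case x of Gen_a \<Rightarrow> (1 :: rat, 0 :: int) | Gen_t \<Rightarrow> (0, 1))" for x
  have k0: "k \<noteq> 0" using k by simp
  interpret P: group "Z_inverted_semidirect_Z k" using k0 by (rule group_Z_inverted_semidirect_Z)
  interpret B: group "presented_group R" by (rule group_presented_group)
  have mem: "0 \<in> Z_inverted k" "1 \<in> Z_inverted k"
    using of_int_in_Z_inverted[of 0 k] of_int_in_Z_inverted[of 1 k] by simp_all
  then have f: "f x \<in> carrier (Z_inverted_semidirect_Z k)" for x
    by (auto simp: f_def Z_inverted_semidirect_Z_def split: BS_gen.splits)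
  have pow_k: "gen_pow Gen_a k = replicate (nat k) (Gen_a, True)"
    using k by (simp add: gen_pow_def)
  have "word_eval (Z_inverted_semidirect_Z k) f (gen_pow Gen_a k) = (of_int k, 0)"
    unfolding pow_k P.word_eval_replicate[OF f]
    using k pow_Z_inverted_semidirect_Z(2)[OF k0, of "nat k"] by (simp add: f_def del: pow_nat)
  moreover have "word_eval (Z_inverted_semidirect_Z k) f
      (gen_pow Gen_t 1 @ gen_pow Gen_a 1 @ gen_pow Gen_t (- 1)) = (of_int k, 0)"
    using inv_Z_inverted_semidirect_Z[OF k0 mem(1), of 1]
    by (simp add: word_eval_def gen_pow_def f_def) (simp add: Z_inverted_semidirect_Z_def)
  ultimately obtain \<phi> where \<phi>: "\<phi> \<in> hom (presented_group R) (Z_inverted_semidirect_Z k)"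
      "\<And>x. \<phi> (gen x) = f x"
    using P.presented_group_hom[of f R] f unfolding gen_def R_def by auto
  have "UNIV = {Gen_a, Gen_t}" using BS_gen.exhaust by blast
  then have range: "range gen = {gen Gen_a, gen Gen_t}" by (metis image_empty image_insert)
  have "gen Gen_t \<otimes>\<^bsub>presented_group R\<^esub> gen Gen_a \<otimes>\<^bsub>presented_group R\<^esub> inv\<^bsub>presented_group R\<^esub> gen Gen_t
      = word_class R (gen_pow Gen_a k)"
    unfolding gen_def inv_word_class_letter mult_presented_group word_class_eq_iff
    by (rule presented_eq.relation) (simp add: R_def gen_pow_def)
  also have "\<dots> = gen Gen_a [^]\<^bsub>presented_group R\<^esub> k"
    using k int_pow_int[of "presented_group R" "gen Gen_a" "nat k"]
    by (simp add: pow_k word_class_replicate gen_def)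
  finally have "affine_coordinates (presented_group R) k (gen Gen_a) (gen Gen_t) \<phi>"
    using k \<phi> generate_presented_group[of R] range
    by unfold_locales (auto simp: f_def gen_def carrier_presented_group)
  then show ?thesis using that by (simp add: BS)
qed

theorem theorem1p6:
  fixes k :: int
  assumes "k \<ge> 2"
  shows "BS 1 k \<cong> Z_inverted_semidirect_Z k \<and> uq_setting (BS 1 k) \<and> \<not> has_uq (BS 1 k)"
proof -
  obtain a t \<phi> where "affine_coordinates (BS 1 k) k a t \<phi>"
    using BS_affine_coordinates[OF assms] .
  then interpret affine_coordinates "BS 1 k" k a t \<phi> .
  show ?thesis
    using \<phi>_iso is_isoI uq_setting not_has_uq by blast
qed

end
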